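(* Let $k\ge 1$ and let $A\in GL_k(\mathbf{Q})\cap M_k(\mathbf{Z})$ have an eigenvalue $\lambda\in\mathbf{C}$ with $|\lambda|>1$. Let $\mu$ be a probability distribution on $\mathbf{Z}^k$ whose support is not parallel to a proper subspace of $\mathbf{Q}^k$ invariant under $A$, let $\{\mathbf{B}_n\}_{n\ge 0}$ be independent random vectors in $\mathbf{Z}^k$ with common law $\mu$, and suppose $\|\mathbf{B}_n\|_\infty\in L^2$ for all $n\in\mathbf{N}$. Let $\mathbf{x}_0\in\mathbf{Z}^k$. For each modulus $p$ let $\mathbf{X}_{n+1}=A\mathbf{X}_n+\mathbf{B}_n$ (mod $p$), $\mathbf{X}_0=\mathbf{x}_0$, and let $P_n$ be the law of $\mathbf{X}_n$ on $\mathbf{Z}_p^k$. Let $B=(\mathbf{y}_1\,\dots\,\mathbf{y}_k)$ be a matrix whose columns form a basis of $\mathbf{Q}^k$ contained in $V^{d-1}$. Then there exist $c\in\mathbf{R}^{+}$, $N\in\mathbf{N}$ and a function $\eta$ with $\lim_{p\to\infty}\eta(p)=1$ such that, for all $p\in\mathbf{N}$ with $p>N$ and $\gcd(\det(A),p)=\gcd(\det(B),p)=1$, and for all $n\in\mathbf{N}$ with $n\le c\ln p$, $$\|P_n-U\|\ge \frac12\,\eta(p).$$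
   Context: $\mathbf{Z}_p^k=(\mathbf{Z}/p\mathbf{Z})^k$; $U$ is the uniform distribution on $\mathbf{Z}_p^k$; $\|P_n-U\|=\frac12\sum_{\mathbf{x}\in\mathbf{Z}_p^k}|P_n(\mathbf{x})-U(\mathbf{x})|$ is the variation distance. $d\le k$ is the degree of the minimum polynomial of $A$. The support of $\mu$ is parallel to a subspace $W\subset\mathbf{Q}^k$ if it is contained in some translate $\mathbf{v}+W$; "proper" means $W\neq\mathbf{Q}^k$ (so $W=\{\mathbf 0\}$ is allowed). Set $V=\{\mathbf{h}-\mathbf{k}:\mathbf{h},\mathbf{k}\in\operatorname{supp}\mu\}$ and $V^{d-1}=\{A^m\mathbf{x}:\mathbf{x}\in V,\ m=0,1,\dots,d-1\}$. Under the hypothesis on the support of $\mu$, $V^{d-1}$ contains a basis of $\mathbf{Q}^k$; one such basis $\{\mathbf{y}_1,\dots,\mathbf{y}_k\}$ is fixed and $B$ is the integer matrix with these columns. $\|\mathbf{B}_n\|_\infty\in L^2$ means $E[\|\mathbf{B}_n\|_\infty^2]<\infty$, with $\|\cdot\|_\infty$ the maximum norm. The matrix $A$, the law $\mu$ and the vector $\mathbf{x}_0$ do not depend on $p$. *)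

theory Defs
  imports "HOL-Probability.Probability" "HOL-Computational_Algebra.Polynomial"
begin

section \<open>Matrices\<close>

(* The class instance of power on 'a^'n^'n multiplies componentwise, so it is not usable here. *)
primrec matrix_power :: "'a::semiring_1^'n^'n \<Rightarrow> nat \<Rightarrow> 'a^'n^'n" where
  "matrix_power A 0 = mat 1"
| "matrix_power A (Suc m) = A ** matrix_power A m"

definition poly_matrix :: "'a::comm_ring_1 poly \<Rightarrow> 'a^'n^'n \<Rightarrow> 'a^'n^'n" where
  "poly_matrix q A = (\<chi> i j. \<Sum>m\<le>degree q. coeff q m * matrix_power A m $ i $ j)"

definition is_min_poly :: "'a::field^'n^'n \<Rightarrow> 'a poly \<Rightarrow> bool" where
  "is_min_poly A q \<longleftrightarrow> lead_coeff q = 1 \<and> poly_matrix q A = 0 \<and>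
     (\<forall>r. r \<noteq> 0 \<and> poly_matrix r A = 0 \<longrightarrow> degree q \<le> degree r)"

definition min_poly :: "'a::field^'n^'n \<Rightarrow> 'a poly" where
  "min_poly A = (THE q. is_min_poly A q)"

definition eigenvalue_of :: "'a::field^'n^'n \<Rightarrow> 'a \<Rightarrow> bool" where
  "eigenvalue_of A l \<longleftrightarrow> (\<exists>v. v \<noteq> 0 \<and> A *v v = l *s v)"

lemma poly_matrix_le:
  assumes "degree q \<le> n"
  shows "poly_matrix q A = (\<chi> i j. \<Sum>m\<le>n. coeff q m * matrix_power A m $ i $ j)"
  unfolding poly_matrix_def vec_eq_iff using assms
  by (auto intro!: sum.mono_neutral_left le_degree)

lemma poly_matrix_diff:
  "poly_matrix (q - r) A = poly_matrix q A - poly_matrix r A"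
proof -
  define n where "n = max (degree q) (degree r)"
  have "degree q \<le> n" "degree r \<le> n" "degree (q - r) \<le> n"
    by (auto simp: n_def degree_diff_le_max)
  then show ?thesis
    by (simp add: poly_matrix_le[where n = n] vec_eq_iff algebra_simps sum_subtractf)
qed

lemma poly_matrix_smult:
  "poly_matrix (smult c q) A = (\<chi> i j. c * poly_matrix q A $ i $ j)"
  by (simp only: poly_matrix_le[OF degree_smult_le[of c q]] poly_matrix_def[of q] vec_lambda_beta
      sum_distrib_left coeff_smult mult.assoc)

lemma annihilating_poly_exists:
  fixes A :: "'a::field^'n^'n"
  shows "\<exists>q. q \<noteq> 0 \<and> poly_matrix q A = 0"
proof -
  define f :: "nat \<Rightarrow> 'a^('n \<times> 'n)" where
    "f m = (\<chi> z. matrix_power A m $ fst z $ snd z)" for m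
  define N where "N = CARD('n \<times> 'n)"
  have "\<exists>u. (\<exists>m\<le>N. u m \<noteq> 0) \<and> (\<Sum>m\<le>N. u m *s f m) = 0"
  proof (cases "inj_on f {..N}")
    case True
    have "vec.dependent (f ` {..N})"
    proof (rule ccontr)
      assume "\<not> vec.dependent (f ` {..N})"
      then have "card (f ` {..N}) \<le> vec.dim (f ` {..N})"
        using vec.independent_bound_general by blast
      also have "\<dots> \<le> N"
        unfolding N_def by (rule dim_subset_UNIV_cart_gen)
      finally show False
        using True by (simp add: card_image)
    qed
    then obtain u where u: "\<exists>v\<in>f ` {..N}. u v \<noteq> 0" "(\<Sum>v\<in>f ` {..N}. u v *s v) = 0"
      by (subst (asm) vec.dependent_finite) auto
    then show ?thesis
      using True by (intro exI[of _ "u \<circ> f"]) (auto simp: sum.reindex)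
  next
    case False
    then obtain a b where ab: "a \<le> N" "b \<le> N" "a \<noteq> b" "f a = f b"
      by (auto simp: inj_on_def)
    define u :: "nat \<Rightarrow> 'a" where "u m = (if m = a then 1 else if m = b then -1 else 0)" for m
    have "(\<Sum>m\<le>N. u m *s f m) = (\<Sum>m\<in>{a, b}. u m *s f m)"
      using ab by (intro sum.mono_neutral_right) (auto simp: u_def)
    also have "\<dots> = 0"
      using ab by (simp add: u_def)
    finally show ?thesis
      using ab by (intro exI[of _ u]) (auto simp: u_def)
  qed
  then obtain u m0 where u: "m0 \<le> N" "u m0 \<noteq> 0" "(\<Sum>m\<le>N. u m *s f m) = 0"
    by blast
  define q where "q = (\<Sum>m\<le>N. monom (u m) m)"
  have cq: "coeff q m = (if m \<le> N then u m else 0)" for m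
    by (simp add: q_def coeff_sum)
  have "q \<noteq> 0"
    using u cq by (metis coeff_0)
  moreover have "degree q \<le> N"
    by (rule degree_le) (simp add: cq)
  then have "poly_matrix q A = 0"
  proof -
    have "(\<Sum>m\<le>N. u m * matrix_power A m $ i $ j) = 0" for i j
      using arg_cong[OF u(3), of "\<lambda>v. v $ (i, j)"] by (simp add: f_def sum_component)
    then show ?thesis
      by (simp add: poly_matrix_le[OF \<open>degree q \<le> N\<close>] vec_eq_iff cq)
  qed
  ultimately show ?thesis by blast
qed

lemma is_min_poly_unique:
  assumes "is_min_poly A q" "is_min_poly A r"
  shows "q = r"
proof (rule ccontr)
  assume "q \<noteq> r"
  have deg: "degree q = degree r"
    using assms unfolding is_min_poly_def by (metis le_antisym leading_coeff_0_iff zero_neq_one)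
  have "poly_matrix (q - r) A = 0"
    using assms by (simp add: poly_matrix_diff is_min_poly_def)
  then have *: "degree q \<le> degree (q - r)"
    using assms(1) \<open>q \<noteq> r\<close> by (simp add: is_min_poly_def)
  moreover have "degree (q - r) \<le> degree q"
    using deg by (simp add: degree_diff_le)
  moreover have "coeff (q - r) (degree q) = 0"
    using assms deg by (simp add: is_min_poly_def)
  ultimately have "lead_coeff (q - r) = 0"
    by (metis le_antisym)
  then show False
    using \<open>q \<noteq> r\<close> leading_coeff_0_iff[of "q - r"] by auto
qed

lemma is_min_poly_min_poly: "is_min_poly A (min_poly A)"
proof -
  let ?P = "\<lambda>q. q \<noteq> 0 \<and> poly_matrix q A = 0"
  obtain q0 where "?P q0"
    using annihilating_poly_exists by blast
  define q where "q = arg_min degree ?P"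
  have q: "q \<noteq> 0" "poly_matrix q A = 0"
    and min: "\<And>r. r \<noteq> 0 \<Longrightarrow> poly_matrix r A = 0 \<Longrightarrow> degree q \<le> degree r"
    using arg_min_nat_lemma[of ?P q0 degree] \<open>?P q0\<close> unfolding q_def by blast+
  let ?q = "smult (inverse (lead_coeff q)) q"
  have "is_min_poly A ?q"
    using q min by (simp add: is_min_poly_def poly_matrix_smult vec_eq_iff)
  then show ?thesis
    unfolding min_poly_def by (rule theI) (rule is_min_poly_unique[OF _ \<open>is_min_poly A ?q\<close>])
qed

section \<open>Integer vectors and subspaces of rational vectors\<close>

definition rat_vec :: "int^'n \<Rightarrow> rat^'n" where
  "rat_vec x = (\<chi> i. rat_of_int (x $ i))"

definition max_norm :: "int^'n::finite \<Rightarrow> int" where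
  "max_norm x = Max (range (\<lambda>i. \<bar>x $ i\<bar>))"

definition invariant_under :: "rat^'n^'n \<Rightarrow> (rat^'n) set \<Rightarrow> bool" where
  "invariant_under A W \<longleftrightarrow> (\<forall>w\<in>W. A *v w \<in> W)"

definition parallel_to :: "(int^'n) set \<Rightarrow> (rat^'n) set \<Rightarrow> bool" where
  "parallel_to S W \<longleftrightarrow> (\<exists>v. rat_vec ` S \<subseteq> (\<lambda>w. v + w) ` W)"

definition support_differences :: "(int^'n) pmf \<Rightarrow> (int^'n) set" where
  "support_differences \<mu> = {h - k | h k. h \<in> set_pmf \<mu> \<and> k \<in> set_pmf \<mu>}"

(* The set written V^{d-1}: the exponents m are 0, ..., d - 1. *)
definition iterated_differences :: "int^'n^'n \<Rightarrow> (int^'n) pmf \<Rightarrow> (int^'n) set" where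
  "iterated_differences A \<mu> =
     {matrix_power A m *v x | m x.
        x \<in> support_differences \<mu> \<and> m < degree (min_poly (map_matrix rat_of_int A))}"

definition columns_form_basis :: "'a::field^'n^'n \<Rightarrow> bool" where
  "columns_form_basis B \<longleftrightarrow>
     inj (\<lambda>j. column j B) \<and> vec.independent (columns B) \<and> vec.span (columns B) = UNIV"

section \<open>The random walk modulo p\<close>

(* Elements of (Z/pZ)^k are represented by their coordinatewise least nonnegative residues. *)
definition residue_vecs :: "nat \<Rightarrow> (int^'n) set" where
  "residue_vecs p = {x. \<forall>i. 0 \<le> x $ i \<and> x $ i < int p}"

definition vec_mod :: "int^'n \<Rightarrow> nat \<Rightarrow> int^'n" where
  "vec_mod x p = (\<chi> i. x $ i mod int p)"

primrec affine_walk ::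
  "int^'n^'n \<Rightarrow> int^'n \<Rightarrow> (nat \<Rightarrow> 'w \<Rightarrow> int^'n) \<Rightarrow> nat \<Rightarrow> nat \<Rightarrow> 'w \<Rightarrow> int^'n" where
  "affine_walk A x0 b p 0 \<omega> = vec_mod x0 p"
| "affine_walk A x0 b p (Suc n) \<omega> = vec_mod (A *v affine_walk A x0 b p n \<omega> + b n \<omega>) p"

definition walk_law ::
  "'w measure \<Rightarrow> int^'n^'n \<Rightarrow> int^'n \<Rightarrow> (nat \<Rightarrow> 'w \<Rightarrow> int^'n) \<Rightarrow> nat \<Rightarrow> nat \<Rightarrow> (int^'n) measure"
where
  "walk_law M A x0 b p n = distr M (count_space UNIV) (affine_walk A x0 b p n)"

definition uniform_dist :: "nat \<Rightarrow> (int^'n) pmf" where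
  "uniform_dist p = pmf_of_set (residue_vecs p)"

definition variation_distance :: "nat \<Rightarrow> (int^'n) measure \<Rightarrow> (int^'n) measure \<Rightarrow> real" where
  "variation_distance p P Q = 1/2 * (\<Sum>x\<in>residue_vecs p. \<bar>measure P {x} - measure Q {x}\<bar>)"

lemma bij_betw_residue_vecs:
  "bij_betw vec_lambda (PiE (UNIV :: 'n::finite set) (\<lambda>_. {0..<int p})) (residue_vecs p)"
proof (rule bij_betwI[where g = vec_nth])
  show "vec_lambda \<in> PiE (UNIV :: 'n set) (\<lambda>_. {0..<int p}) \<rightarrow> residue_vecs p"
    by (rule funcsetI) (simp add: residue_vecs_def PiE_iff)
  show "vec_nth \<in> residue_vecs p \<rightarrow> PiE (UNIV :: 'n set) (\<lambda>_. {0..<int p})"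
    by (rule funcsetI) (simp add: residue_vecs_def PiE_iff)
qed (simp_all add: fun_eq_iff)

lemma finite_residue_vecs: "finite (residue_vecs p :: (int^'n) set)"
  using bij_betw_finite[OF bij_betw_residue_vecs] by (simp add: finite_PiE)

lemma card_residue_vecs: "card (residue_vecs p :: (int^'n) set) = p ^ CARD('n)"
  using bij_betw_same_card[OF bij_betw_residue_vecs[of p, where 'n = 'n]]
  by (simp add: card_PiE)

end

theory Submission
  imports Defs
begin

text \<open>
  The walk modulo \<open>p\<close> is the reduction of a walk on the integer lattice, and in \<open>n\<close> steps the
  lattice walk moves only a distance of order \<open>R ^ n\<close> in mean, where \<open>R\<close> bounds the operator norm
  of \<open>A\<close> for the maximum norm: one step multiplies the mean norm by at most \<open>R\<close> and adds the mean
  norm of one increment (\<open>lifted_walk_expectation_bound\<close>). If \<open>n \<le> ln p / (4 * ln R)\<close>, then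
  \<open>R ^ n \<le> p powr (1/4)\<close>, so by Markov's inequality the lattice walk lies in the box of radius
  \<open>sqrt p\<close> up to a probability of order \<open>p powr (-1/4)\<close>. That box has only about
  \<open>(2 * sqrt p) ^ k\<close> points, a vanishing fraction of the \<open>p ^ k\<close> residue vectors.

  Hence the reduction of the box is a set to which the walk gives mass tending to 1 and the uniform
  distribution gives mass tending to 0, at rates that do not depend on \<open>n\<close>; these rates give
  a lower bound \<open>\<eta> p\<close> for the difference of the two masses.
\<close>

section \<open>The maximum norm on integer vectors\<close>

lemma max_norm_le_iff: "max_norm x \<le> r \<longleftrightarrow> (\<forall>i. \<bar>x $ i\<bar> \<le> r)"
  by (auto simp: max_norm_def)

lemma abs_nth_le_max_norm: "\<bar>x $ i\<bar> \<le> max_norm x"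
  using max_norm_le_iff[of x "max_norm x"] by auto

lemma max_norm_nonneg: "0 \<le> max_norm x"
  using abs_nth_le_max_norm[of x] abs_ge_zero order_trans by blast

lemma max_norm_add_le: "max_norm (x + y) \<le> max_norm x + max_norm y"
  unfolding max_norm_le_iff[of "x + y"]
proof
  fix i
  have "\<bar>(x + y) $ i\<bar> \<le> \<bar>x $ i\<bar> + \<bar>y $ i\<bar>" by simp
  also have "\<dots> \<le> max_norm x + max_norm y"
    by (intro add_mono abs_nth_le_max_norm)
  finally show "\<bar>(x + y) $ i\<bar> \<le> max_norm x + max_norm y" .
qed

definition entry_sum :: "int^'n^'m \<Rightarrow> int" where
  "entry_sum A = (\<Sum>i\<in>UNIV. \<Sum>j\<in>UNIV. \<bar>A $ i $ j\<bar>)"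

lemma entry_sum_nonneg: "0 \<le> entry_sum A"
  by (auto simp: entry_sum_def intro!: sum_nonneg)

lemma max_norm_matrix_vector_mult_le:
  "max_norm (A *v x) \<le> entry_sum A * max_norm x"
  unfolding max_norm_le_iff[of "A *v x"]
proof
  fix i
  have "\<bar>(A *v x) $ i\<bar> \<le> (\<Sum>j\<in>UNIV. \<bar>A $ i $ j * x $ j\<bar>)"
    by (simp add: matrix_vector_mult_def)
  also have "\<dots> \<le> (\<Sum>j\<in>UNIV. \<bar>A $ i $ j\<bar> * max_norm x)"
    by (intro sum_mono) (simp add: abs_mult mult_left_mono abs_nth_le_max_norm)
  also have "\<dots> = (\<Sum>j\<in>UNIV. \<bar>A $ i $ j\<bar>) * max_norm x"
    by (simp add: sum_distrib_right)
  also have "\<dots> \<le> entry_sum A * max_norm x"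
    unfolding entry_sum_def
    by (intro mult_right_mono max_norm_nonneg member_le_sum[of i UNIV "\<lambda>i. \<Sum>j\<in>UNIV. \<bar>A $ i $ j\<bar>"])
      (auto intro: sum_nonneg)
  finally show "\<bar>(A *v x) $ i\<bar> \<le> entry_sum A * max_norm x" .
qed

definition int_box :: "int \<Rightarrow> (int^'n) set" where
  "int_box r = {x. max_norm x \<le> r}"

lemma int_box_eq: "int_box r = vec_lambda ` (PiE (UNIV :: 'n::finite set) (\<lambda>_. {-r..r}))"
proof
  show "int_box r \<subseteq> vec_lambda ` (PiE (UNIV :: 'n set) (\<lambda>_. {-r..r}))"
  proof
    fix x :: "int^'n" assume "x \<in> int_box r"
    then have "\<bar>x $ i\<bar> \<le> r" for i
      by (simp add: int_box_def max_norm_le_iff)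
    then have "vec_nth x \<in> PiE UNIV (\<lambda>_. {-r..r})"
      by (auto simp: PiE_iff abs_le_iff minus_le_iff)
    then show "x \<in> vec_lambda ` (PiE (UNIV :: 'n set) (\<lambda>_. {-r..r}))"
      by (rule rev_image_eqI) simp
  qed
next
  show "vec_lambda ` (PiE (UNIV :: 'n set) (\<lambda>_. {-r..r})) \<subseteq> int_box r"
    by (auto simp: int_box_def max_norm_le_iff PiE_iff abs_le_iff minus_le_iff)
qed

lemma finite_int_box: "finite (int_box r :: (int^'n) set)"
  unfolding int_box_eq by (intro finite_imageI finite_PiE) auto

lemma card_int_box_le: "card (int_box r :: (int^'n) set) \<le> nat (2 * r + 1) ^ CARD('n)"
proof -
  have "card (int_box r :: (int^'n) set) \<le> card (PiE (UNIV :: 'n set) (\<lambda>_. {-r..r}))"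
    unfolding int_box_eq by (intro card_image_le finite_PiE) auto
  also have "\<dots> = nat (2 * r + 1) ^ CARD('n)"
    by (simp add: card_PiE)
  finally show ?thesis .
qed

section \<open>Lifting the walk to the integer lattice\<close>

primrec lifted_walk ::
  "int^'n^'n \<Rightarrow> int^'n \<Rightarrow> (nat \<Rightarrow> 'w \<Rightarrow> int^'n) \<Rightarrow> nat \<Rightarrow> 'w \<Rightarrow> int^'n" where
  "lifted_walk A x0 b 0 \<omega> = x0"
| "lifted_walk A x0 b (Suc n) \<omega> = A *v lifted_walk A x0 b n \<omega> + b n \<omega>"

lemma vec_mod_affine_step: "vec_mod (A *v vec_mod x p + y) p = vec_mod (A *v x + y) p"
proof -
  have "((\<Sum>j\<in>UNIV. A $ i $ j * (x $ j mod int p)) + y $ i) mod int p =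
        ((\<Sum>j\<in>UNIV. A $ i $ j * x $ j) + y $ i) mod int p" for i
  proof (rule mod_add_cong[OF _ refl])
    have "(\<Sum>j\<in>UNIV. A $ i $ j * (x $ j mod int p)) mod int p =
          (\<Sum>j\<in>UNIV. A $ i $ j * (x $ j mod int p) mod int p) mod int p"
      by (rule mod_sum_eq[symmetric])
    also have "\<dots> = (\<Sum>j\<in>UNIV. A $ i $ j * x $ j mod int p) mod int p"
      by (simp add: mod_mult_right_eq)
    also have "\<dots> = (\<Sum>j\<in>UNIV. A $ i $ j * x $ j) mod int p"
      by (rule mod_sum_eq)
    finally show "(\<Sum>j\<in>UNIV. A $ i $ j * (x $ j mod int p)) mod int p =
          (\<Sum>j\<in>UNIV. A $ i $ j * x $ j) mod int p" .
  qed
  then show ?thesis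
    by (simp add: vec_mod_def vec_eq_iff matrix_vector_mult_def)
qed

lemma affine_walk_eq_vec_mod_lifted_walk:
  "affine_walk A x0 b p n \<omega> = vec_mod (lifted_walk A x0 b n \<omega>) p"
  by (induction n) (simp_all add: vec_mod_affine_step)

lemma lifted_walk_measurable:
  assumes b: "\<And>n. b n \<in> M \<rightarrow>\<^sub>M count_space UNIV"
  shows "lifted_walk A x0 b n \<in> M \<rightarrow>\<^sub>M count_space UNIV"
proof (induction n)
  case 0
  then show ?case by (simp add: lifted_walk.simps(1)[abs_def])
next
  case (Suc n)
  have "(\<lambda>\<omega>. (\<lambda>x \<omega>. A *v x + b n \<omega>) (lifted_walk A x0 b n \<omega>) \<omega>) \<in> M \<rightarrow>\<^sub>M count_space UNIV"
    using Suc.IH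
    by (rule measurable_compose_countable[rotated]) (rule measurable_compose[OF b], simp)
  then show ?case by (simp add: lifted_walk.simps(2)[abs_def])
qed

section \<open>Growth of the lifted walk in mean\<close>

text \<open>
  The mean norm \<open>e n\<close> satisfies \<open>e (n + 1) \<le> R * e n + m\<close>. The summand \<open>- m\<close> in the bound makes it
  reproduce itself under this recursion: since \<open>R \<ge> 2\<close>, the constant produced by one more step is
  \<open>- R * m + m \<le> - m\<close>.
\<close>

lemma lifted_walk_expectation_bound:
  fixes A :: "int^'n^'n"
  assumes "prob_space M"
    and b: "\<And>n. b n \<in> M \<rightarrow>\<^sub>M count_space UNIV"
    and int: "\<And>n. integrable M (\<lambda>\<omega>. real_of_int (max_norm (b n \<omega>)))"
    and mean: "\<And>n. (\<integral>\<omega>. real_of_int (max_norm (b n \<omega>)) \<partial>M) \<le> m"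
    and R: "real_of_int (entry_sum A) \<le> R" "2 \<le> R"
  shows "integrable M (\<lambda>\<omega>. real_of_int (max_norm (lifted_walk A x0 b n \<omega>)))"
    and "(\<integral>\<omega>. real_of_int (max_norm (lifted_walk A x0 b n \<omega>)) \<partial>M)
           \<le> (real_of_int (max_norm x0) + m) * R ^ n - m"
proof -
  interpret prob_space M by fact
  let ?N = "\<lambda>n \<omega>. real_of_int (max_norm (lifted_walk A x0 b n \<omega>))"
  let ?b = "\<lambda>n \<omega>. real_of_int (max_norm (b n \<omega>))"
  have m: "0 \<le> m"
    by (rule order_trans[OF _ mean[of 0]]) (simp add: max_norm_nonneg)
  have step: "?N (Suc n) \<omega> \<le> R * ?N n \<omega> + ?b n \<omega>" for n \<omega>
  proof -
    let ?x = "lifted_walk A x0 b n \<omega>"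
    have "max_norm (A *v ?x + b n \<omega>) \<le> entry_sum A * max_norm ?x + max_norm (b n \<omega>)"
      using max_norm_add_le[of "A *v ?x" "b n \<omega>"] max_norm_matrix_vector_mult_le[of A ?x]
      by linarith
    then have "?N (Suc n) \<omega> \<le> real_of_int (entry_sum A) * ?N n \<omega> + ?b n \<omega>"
      by (simp flip: of_int_mult of_int_add)
    also have "\<dots> \<le> R * ?N n \<omega> + ?b n \<omega>"
      using R(1) by (intro add_right_mono mult_right_mono) (simp_all add: max_norm_nonneg)
    finally show ?thesis .
  qed
  have meas: "?N n \<in> borel_measurable M" for n
    by (rule measurable_compose[OF lifted_walk_measurable[OF b]]) simp
  have both: "integrable M (?N n) \<and>
      (\<integral>\<omega>. ?N n \<omega> \<partial>M) \<le> (real_of_int (max_norm x0) + m) * R ^ n - m"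
  proof (induction n)
    case 0
    then show ?case by (simp add: prob_space)
  next
    case (Suc n)
    have dom: "integrable M (\<lambda>\<omega>. R * ?N n \<omega> + ?b n \<omega>)"
      using Suc.IH int by auto
    have intS: "integrable M (?N (Suc n))"
    proof (rule Bochner_Integration.integrable_bound[OF dom meas], rule AE_I2)
      fix \<omega>
      have "0 \<le> ?N (Suc n) \<omega>" by (simp only: of_int_0_le_iff max_norm_nonneg)
      then show "norm (?N (Suc n) \<omega>) \<le> norm (R * ?N n \<omega> + ?b n \<omega>)"
        using step[of n \<omega>] by (simp only: real_norm_def)
    qed
    have "(\<integral>\<omega>. ?N (Suc n) \<omega> \<partial>M) \<le> (\<integral>\<omega>. R * ?N n \<omega> + ?b n \<omega> \<partial>M)"
      by (rule integral_mono[OF intS dom step])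
    also have "\<dots> = R * (\<integral>\<omega>. ?N n \<omega> \<partial>M) + (\<integral>\<omega>. ?b n \<omega> \<partial>M)"
      using Suc.IH int by simp
    also have "\<dots> \<le> R * ((real_of_int (max_norm x0) + m) * R ^ n - m) + m"
      using Suc.IH mean[of n] R(2) by (intro add_mono mult_left_mono) auto
    also have "\<dots> \<le> (real_of_int (max_norm x0) + m) * R ^ Suc n - m"
      using mult_right_mono[OF R(2) m] by (simp add: algebra_simps)
    finally show ?case using intS by blast
  qed
  show "integrable M (?N n)"
    using both by blast
  show "(\<integral>\<omega>. ?N n \<omega> \<partial>M) \<le> (real_of_int (max_norm x0) + m) * R ^ n - m"
    using both by blast
qed

section \<open>A lower bound for the variation distance\<close>

text \<open>
  Only the terms of the sum with \<open>x \<in> S\<close> are kept. The constant 1/2 comes from the discarded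
  complement of \<open>S\<close>, which contributes at least \<open>measure P S - measure Q S\<close> once more when both
  measures have total mass 1 on the residue vectors.
\<close>

lemma variation_distance_ge_half_diff:
  assumes "S \<subseteq> residue_vecs p"
    and "finite_measure P" "finite_measure Q"
    and "sets P = UNIV" "sets Q = UNIV"
  shows "variation_distance p P Q \<ge> 1/2 * (measure P S - measure Q S)"
proof -
  have fin: "finite S"
    using assms(1) finite_residue_vecs finite_subset by blast
  have "measure P S - measure Q S = (\<Sum>x\<in>S. measure P {x} - measure Q {x})"
    using finite_measure.finite_measure_eq_sum_singleton[OF assms(2) fin]
      finite_measure.finite_measure_eq_sum_singleton[OF assms(3) fin] assms(4,5)
    by (simp add: sum_subtractf)
  also have "\<dots> \<le> (\<Sum>x\<in>S. \<bar>measure P {x} - measure Q {x}\<bar>)"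
    by (intro sum_mono) simp
  also have "\<dots> \<le> (\<Sum>x\<in>residue_vecs p. \<bar>measure P {x} - measure Q {x}\<bar>)"
    using assms(1) by (intro sum_mono2 finite_residue_vecs) auto
  finally show ?thesis
    by (simp add: variation_distance_def)
qed

lemma vec_mod_in_residue_vecs: "p > 0 \<Longrightarrow> vec_mod x p \<in> residue_vecs p"
  by (simp add: vec_mod_def residue_vecs_def)

lemma uniform_dist_reduced_box_le:
  assumes "p > 0"
  shows "measure (measure_pmf (uniform_dist p))
           ((\<lambda>x. vec_mod x p) ` (int_box \<lfloor>sqrt p\<rfloor> :: (int^'n) set)) \<le> (3 / sqrt p) ^ CARD('n)"
proof -
  let ?S = "(\<lambda>x. vec_mod x p) ` (int_box \<lfloor>sqrt p\<rfloor> :: (int^'n) set)"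
  have ne: "residue_vecs p \<noteq> ({} :: (int^'n) set)"
    using vec_mod_in_residue_vecs[OF assms] by blast
  have sub: "?S \<subseteq> residue_vecs p"
    using vec_mod_in_residue_vecs[OF assms] by blast
  have sqrt1: "1 \<le> sqrt p"
    using assms by simp
  have "card ?S \<le> nat (2 * \<lfloor>sqrt p\<rfloor> + 1) ^ CARD('n)"
    using card_image_le[OF finite_int_box] card_int_box_le order_trans by blast
  then have "real (card ?S) \<le> real (nat (2 * \<lfloor>sqrt p\<rfloor> + 1)) ^ CARD('n)"
    unfolding of_nat_power[symmetric] by (rule of_nat_mono)
  also have "\<dots> \<le> (3 * sqrt p) ^ CARD('n)"
  proof (intro power_mono)
    have "real (nat (2 * \<lfloor>sqrt p\<rfloor> + 1)) = 2 * real_of_int \<lfloor>sqrt p\<rfloor> + 1"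
      by (simp add: of_nat_nat)
    also have "\<dots> \<le> 3 * sqrt p"
      using sqrt1 of_int_floor_le[of "sqrt p"] by linarith
    finally show "real (nat (2 * \<lfloor>sqrt p\<rfloor> + 1)) \<le> 3 * sqrt p" .
  qed simp
  finally have card: "real (card ?S) \<le> (3 * sqrt p) ^ CARD('n)" .
  have "measure (measure_pmf (uniform_dist p)) ?S = real (card ?S) / real p ^ CARD('n)"
    unfolding uniform_dist_def using sub
    by (subst measure_pmf_of_set[OF ne finite_residue_vecs])
      (simp add: card_residue_vecs Int_absorb1)
  also have "\<dots> \<le> (3 * sqrt p) ^ CARD('n) / real p ^ CARD('n)"
    using card by (rule divide_right_mono) simp
  also have "\<dots> = (3 / sqrt p) ^ CARD('n)"
  proof -
    have "3 * sqrt p / real p = 3 / sqrt p"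
      using assms by (simp add: field_simps)
    then show ?thesis by (metis power_divide)
  qed
  finally show ?thesis .
qed

text \<open>
  Markov's inequality for the norm of the lifted walk. Since norms are integers, a norm below
  \<open>sqrt p\<close> is at most the integer part of \<open>sqrt p\<close>.
\<close>

lemma walk_law_reduced_box_ge:
  fixes A :: "int^'n^'n"
  assumes "prob_space M"
    and b: "\<And>n. b n \<in> M \<rightarrow>\<^sub>M count_space UNIV"
    and int: "integrable M (\<lambda>\<omega>. real_of_int (max_norm (lifted_walk A x0 b n \<omega>)))"
    and mean: "(\<integral>\<omega>. real_of_int (max_norm (lifted_walk A x0 b n \<omega>)) \<partial>M) \<le> E"
    and "p > 0"
  shows "measure (walk_law M A x0 b p n) ((\<lambda>x. vec_mod x p) ` int_box \<lfloor>sqrt p\<rfloor>) \<ge> 1 - E / sqrt p"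
proof -
  interpret prob_space M by fact
  let ?N = "\<lambda>\<omega>. real_of_int (max_norm (lifted_walk A x0 b n \<omega>))"
  let ?S = "(\<lambda>x. vec_mod x p) ` (int_box \<lfloor>sqrt p\<rfloor> :: (int^'n) set)"
  have lift: "lifted_walk A x0 b n \<in> M \<rightarrow>\<^sub>M count_space UNIV"
    by (rule lifted_walk_measurable[OF b])
  have walk: "affine_walk A x0 b p n \<in> M \<rightarrow>\<^sub>M count_space UNIV"
    unfolding affine_walk_eq_vec_mod_lifted_walk[abs_def]
    by (rule measurable_compose[OF lift]) simp
  have far: "{\<omega> \<in> space M. sqrt p \<le> ?N \<omega>} \<in> sets M"
    using borel_measurable_integrable[OF int] by measurable
  have "prob {\<omega> \<in> space M. sqrt p \<le> ?N \<omega>} \<le> (\<integral>\<omega>. ?N \<omega> \<partial>M) / sqrt p"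
    using assms(5)
    by (intro integral_Markov_inequality_measure[OF int, where A = "space M"])
      (auto simp: max_norm_nonneg)
  also have "\<dots> \<le> E / sqrt p"
    using mean by (rule divide_right_mono) simp
  finally have "1 - E / sqrt p \<le> prob (space M - {\<omega> \<in> space M. sqrt p \<le> ?N \<omega>})"
    using prob_compl[OF far] by linarith
  also have "\<dots> \<le> prob (affine_walk A x0 b p n -` ?S \<inter> space M)"
  proof (rule finite_measure_mono)
    show "space M - {\<omega> \<in> space M. sqrt p \<le> ?N \<omega>} \<subseteq> affine_walk A x0 b p n -` ?S \<inter> space M"
      by (auto simp: affine_walk_eq_vec_mod_lifted_walk int_box_def le_floor_iff)
    show "affine_walk A x0 b p n -` ?S \<inter> space M \<in> sets M"
      by (rule measurable_sets[OF walk]) simp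
  qed
  also have "\<dots> = measure (walk_law M A x0 b p n) ?S"
    unfolding walk_law_def by (rule measure_distr[OF walk, symmetric]) simp
  finally show ?thesis .
qed

lemma power_le_powr_quarter:
  fixes R p :: real
  assumes "1 < R" "0 < p" "real n \<le> 1 / (4 * ln R) * ln p"
  shows "R ^ n \<le> p powr (1/4)"
proof -
  have "real n * ln R \<le> 1/4 * ln p"
    using mult_right_mono[OF assms(3), of "ln R"] assms(1) by simp
  then have "exp (real n * ln R) \<le> exp (1/4 * ln p)"
    by simp
  then show ?thesis
    using assms(1,2) by (simp add: powr_def exp_of_nat_mult)
qed

section \<open>Slow mixing up to logarithmic time\<close>

theorem theorem3p10:
  fixes A B :: "int^'k^'k"
    and x0 :: "int^'k"
    and \<mu> :: "(int^'k) pmf"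
    and M :: "'w measure"
    and b :: "nat \<Rightarrow> 'w \<Rightarrow> int^'k"
  assumes "invertible (map_matrix rat_of_int A)"
    and "\<exists>l::complex. eigenvalue_of (map_matrix complex_of_int A) l \<and> cmod l > 1"
    and "\<not> (\<exists>W. vec.subspace W \<and> W \<noteq> UNIV \<and> invariant_under (map_matrix rat_of_int A) W \<and>
               parallel_to (set_pmf \<mu>) W)"
    and "prob_space M"
    and "prob_space.indep_vars M (\<lambda>_. count_space UNIV) b UNIV"
    and "\<And>n. distr M (count_space UNIV) (b n) = measure_pmf \<mu>"
    and "\<And>n. integrable M (\<lambda>\<omega>. (real_of_int (max_norm (b n \<omega>)))\<^sup>2)"
    and "\<And>j. column j B \<in> iterated_differences A \<mu>"
    and "columns_form_basis (map_matrix rat_of_int B)"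
  shows "\<exists>(c::real) (N::nat) (\<eta>::nat \<Rightarrow> real). c > 0 \<and> \<eta> \<longlonglongrightarrow> 1 \<and>
           (\<forall>p>N. coprime (det A) (int p) \<and> coprime (det B) (int p) \<longrightarrow>
              (\<forall>n. real n \<le> c * ln (real p) \<longrightarrow>
                 variation_distance p (walk_law M A x0 b p n) (measure_pmf (uniform_dist p))
                   \<ge> 1/2 * \<eta> p))"
proof -
  interpret prob_space M by fact
  have b: "b n \<in> M \<rightarrow>\<^sub>M count_space UNIV" for n
    using assms(5) by (auto simp: indep_vars_def)
  have int: "integrable M (\<lambda>\<omega>. real_of_int (max_norm (b n \<omega>)))" for n
  proof (rule square_integrable_imp_integrable[OF _ assms(7)])
    show "(\<lambda>\<omega>. real_of_int (max_norm (b n \<omega>))) \<in> borel_measurable M"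
      by (rule measurable_compose[OF b]) simp
  qed
  define m where "m = (\<integral>x. real_of_int (max_norm x) \<partial>measure_pmf \<mu>)"
  have mean: "(\<integral>\<omega>. real_of_int (max_norm (b n \<omega>)) \<partial>M) \<le> m" for n
    unfolding m_def assms(6)[of n, symmetric] by (subst integral_distr[OF b]) simp_all
  have m: "0 \<le> m"
    by (simp add: m_def max_norm_nonneg)
  (* At least 2, so that the bound on the mean norm reproduces itself and ln R is positive. *)
  define R where "R = real_of_int (entry_sum A) + 2"
  have R: "real_of_int (entry_sum A) \<le> R" "2 \<le> R"
    using entry_sum_nonneg[of A] by (simp_all add: R_def)
  define C where "C = real_of_int (max_norm x0) + m"
  have C: "0 \<le> C"
    using m by (simp add: C_def max_norm_nonneg)
  (* Subtracted from 1 are a bound for the mass that the walk has outside the reduced box, by Markov,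
     and a bound for the mass that the uniform law has inside it. *)
  define \<eta> :: "nat \<Rightarrow> real"
    where "\<eta> p = 1 - C * real p powr (1/4) / sqrt p - (3 / sqrt p) ^ CARD('k)" for p
  have eta_limit: "\<eta> \<longlonglongrightarrow> 1"
  proof -
    have sqrt_lim: "filterlim (\<lambda>p::nat. sqrt (real p)) at_top sequentially"
      by (rule filterlim_compose[OF sqrt_at_top filterlim_real_sequentially])
    have eq: "C * real p powr (1/4) / sqrt p = C * real p powr (-(1/4))" for p :: nat
      using powr_diff[of "real p" "1/4" "1/2"] by (simp add: powr_half_sqrt)
    have "(\<lambda>p::nat. C * real p powr (-(1/4))) \<longlonglongrightarrow> C * 0"
      by (intro tendsto_mult tendsto_const tendsto_neg_powr filterlim_real_sequentially) simp
    moreover have "(\<lambda>p::nat. (3 / sqrt (real p)) ^ CARD('k)) \<longlonglongrightarrow> 0 ^ CARD('k)"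
      by (intro tendsto_power tendsto_divide_0[OF tendsto_const]
          filterlim_at_top_imp_at_infinity sqrt_lim)
    ultimately have "(\<lambda>p::nat. 1 - C * real p powr (-(1/4)) - (3 / sqrt (real p)) ^ CARD('k))
        \<longlonglongrightarrow> 1 - C * 0 - 0 ^ CARD('k)"
      by (intro tendsto_diff tendsto_const)
    then show ?thesis
      by (simp add: \<eta>_def[abs_def] eq power_0_left)
  qed
  define c where "c = 1 / (4 * ln R)"
  have bound: "variation_distance p (walk_law M A x0 b p n) (measure_pmf (uniform_dist p))
      \<ge> 1/2 * \<eta> p" if p: "p > 0" and n: "real n \<le> c * ln (real p)" for p n
  proof -
    let ?P = "walk_law M A x0 b p n"
    let ?U = "measure_pmf (uniform_dist p :: (int^'k) pmf)"
    let ?S = "(\<lambda>x. vec_mod x p) ` (int_box \<lfloor>sqrt p\<rfloor> :: (int^'k) set)"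
    have "R ^ n \<le> real p powr (1/4)"
      using power_le_powr_quarter[of R "real p" n] R p n by (simp add: c_def)
    then have "C * R ^ n - m \<le> C * real p powr (1/4)"
      using mult_left_mono[OF _ C] m by fastforce
    then have mean_n: "(\<integral>\<omega>. real_of_int (max_norm (lifted_walk A x0 b n \<omega>)) \<partial>M)
        \<le> C * real p powr (1/4)"
      using lifted_walk_expectation_bound(2)[where b = b, OF assms(4) b int mean R, of x0 n]
      unfolding C_def by linarith
    have walk_mass: "1 - C * real p powr (1/4) / sqrt p \<le> measure ?P ?S"
      by (rule walk_law_reduced_box_ge[OF assms(4) b
            lifted_walk_expectation_bound(1)[OF assms(4) b int mean R] mean_n p])
    have "\<eta> p \<le> measure ?P ?S - measure ?U ?S"
      using diff_mono[OF walk_mass uniform_dist_reduced_box_le[OF p]] unfolding \<eta>_def .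
    then have "1/2 * \<eta> p \<le> 1/2 * (measure ?P ?S - measure ?U ?S)"
      by simp
    also have "\<dots> \<le> variation_distance p ?P ?U"
    proof (rule variation_distance_ge_half_diff)
      show "?S \<subseteq> residue_vecs p"
        using vec_mod_in_residue_vecs[OF p] by blast
      have "affine_walk A x0 b p n \<in> M \<rightarrow>\<^sub>M count_space UNIV"
        unfolding affine_walk_eq_vec_mod_lifted_walk[abs_def]
        by (rule measurable_compose[OF lifted_walk_measurable[OF b]]) simp
      then show "finite_measure ?P"
        unfolding walk_law_def by (rule finite_measure_distr)
    qed (simp_all add: walk_law_def measure_pmf.finite_measure_axioms)
    finally show ?thesis .
  qed
  show ?thesis
  proof (intro exI conjI)
    show "0 < c" using R(2) by (simp add: c_def)
    show "\<eta> \<longlonglongrightarrow> 1" by (rule eta_limit)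
    show "\<forall>p>0. coprime (det A) (int p) \<and> coprime (det B) (int p) \<longrightarrow>
        (\<forall>n. real n \<le> c * ln (real p) \<longrightarrow>
           variation_distance p (walk_law M A x0 b p n) (measure_pmf (uniform_dist p))
             \<ge> 1/2 * \<eta> p)"
      using bound by blast
  qed
qed

end
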